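(* Let $S$ be a semiring having Property (A), $M$ a nonzero $S$-semimodule, and $G$ a cancellative torsion-free commutative monoid. Then the $S[G]$-semimodule $M[G]$ is torsion-free if and only if the $S$-semimodule $M$ is torsion-free.
   Context: A semiring is a set $S$ with operations $+,\cdot$ such that $(S,+)$ is a commutative monoid with identity $0$, $(S,\cdot)$ is a commutative monoid with identity $1\neq 0$, multiplication distributes over addition, and $s\cdot 0=0$ for all $s\in S$. An $S$-semimodule is a commutative monoid $(M,+,0)$ with a scalar multiplication $S\times M\to M$ satisfying the usual module axioms together with $0_S\cdot m=0_M=s\cdot 0_M$ and $1\cdot m=m$. A commutative monoid $G$ (written additively) is cancellative if $a+b=a+c$ implies $b=c$, and torsion-free if $na=nb$ with $n\geq 1$ implies $a=b$. $S[G]$ is the monoid semiring (finite formal sums $\sum s_iX^{g_i}$ with $X^gX^h=X^{g+h}$), and $M[G]$ is the set of finite formal sums $\sum m_iX^{g_i}$, $m_i\in M$, an $S[G]$-semimodule via $(sX^g)(mX^h)=(sm)X^{g+h}$. An ideal of $S$ is a nonempty subset closed under addition and under multiplication by elements of $S$. For a nonzero $S$-semimodule $M$, $Z_S(M)$ is the set of $s\in S$ such that $sm=0$ for some nonzero $m\in M$; $Z(S)=Z_S(S)$. An $S$-semimodule $M$ is torsion-free if $Z_S(M)\subseteq Z(S)$. The semiring $S$ has Property (A) if every finitely generated ideal $I\subseteq Z(S)$ has a nonzero annihilator in $S$, i.e. $s\cdot I=0$ for some nonzero $s\in S$. *)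

theory Defs
  imports "HOL-Library.Poly_Mapping"
begin

text \<open>
  Semirings (commutative, with \<open>1 \<noteq> 0\<close>) are types of class \<^class>\<open>comm_semiring_1\<close>. The monoid
  semiring $S[G]$ is the type \<open>'g \<Rightarrow>\<^sub>0 's\<close> of finitely supported functions with the convolution
  product, and the elements of $M[G]$ are those of \<open>'g \<Rightarrow>\<^sub>0 'm\<close>.
\<close>

locale semimodule =
  fixes scale :: "'s::comm_semiring_1 \<Rightarrow> 'm::comm_monoid_add \<Rightarrow> 'm"
  assumes scale_add_right: "scale s (m + n) = scale s m + scale s n"
    and scale_add_left: "scale (s + t) m = scale s m + scale t m"
    and scale_scale: "scale s (scale t m) = scale (s * t) m"
    and scale_zero_left: "scale 0 m = 0"
    and scale_zero_right: "scale s 0 = 0"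
    and scale_one: "scale 1 m = m"

definition zero_divisors :: "('s \<Rightarrow> 'm::zero \<Rightarrow> 'm) \<Rightarrow> 's set" where
  "zero_divisors scale = {s. \<exists>m. m \<noteq> 0 \<and> scale s m = 0}"

definition torsion_free :: "('s::comm_semiring_1 \<Rightarrow> 'm::zero \<Rightarrow> 'm) \<Rightarrow> bool" where
  "torsion_free scale \<longleftrightarrow> zero_divisors scale \<subseteq> zero_divisors ((*) :: 's \<Rightarrow> 's \<Rightarrow> 's)"

definition semiring_ideal :: "'s::comm_semiring_1 set \<Rightarrow> bool" where
  "semiring_ideal I \<longleftrightarrow> I \<noteq> {} \<and> (\<forall>a\<in>I. \<forall>b\<in>I. a + b \<in> I) \<and> (\<forall>s. \<forall>a\<in>I. s * a \<in> I)"

definition ideal_generated :: "'s::comm_semiring_1 set \<Rightarrow> 's set" where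
  "ideal_generated A = \<Inter>{I. semiring_ideal I \<and> A \<subseteq> I}"

definition finitely_generated_ideal :: "'s::comm_semiring_1 set \<Rightarrow> bool" where
  "finitely_generated_ideal I \<longleftrightarrow> (\<exists>A. finite A \<and> I = ideal_generated A)"

definition property_A :: "'s::comm_semiring_1 itself \<Rightarrow> bool" where
  "property_A _ \<longleftrightarrow>
     (\<forall>I::'s set. finitely_generated_ideal I \<and> I \<subseteq> zero_divisors (*) \<longrightarrow>
        (\<exists>s. s \<noteq> 0 \<and> (\<forall>a\<in>I. s * a = 0)))"

text \<open>The biadditive extension of $(sX^g)(mX^h) = (sm)X^{g+h}$.\<close>

definition monoid_scale ::
  "('s::zero \<Rightarrow> 'm::comm_monoid_add \<Rightarrow> 'm) \<Rightarrow> ('g::comm_monoid_add \<Rightarrow>\<^sub>0 's) \<Rightarrow> ('g \<Rightarrow>\<^sub>0 'm) \<Rightarrow> ('g \<Rightarrow>\<^sub>0 'm)"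
  where
  "monoid_scale scale f p =
     (\<Sum>g\<in>Poly_Mapping.keys f. \<Sum>h\<in>Poly_Mapping.keys p.
        Poly_Mapping.single (g + h) (scale (Poly_Mapping.lookup f g) (Poly_Mapping.lookup p h)))"

lemma poly_mapping_add_single_induct:
  fixes f :: "'a \<Rightarrow>\<^sub>0 'b::comm_monoid_add"
  assumes z: "P 0" and s: "\<And>k v. P (Poly_Mapping.single k v)" and a: "\<And>f g. P f \<Longrightarrow> P g \<Longrightarrow> P (f + g)"
  shows "P f"
proof -
  have "P (\<Sum>k\<in>A. Poly_Mapping.single k (Poly_Mapping.lookup f k))" if "finite A" for A
    using that by (induction A rule: finite_induct) (auto simp: z s a)
  moreover have "f = (\<Sum>k\<in>Poly_Mapping.keys f. Poly_Mapping.single k (Poly_Mapping.lookup f k))"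
    by (rule poly_mapping_eqI)
       (auto simp: lookup_sum lookup_single when_def in_keys_iff)
  ultimately show ?thesis
    by (metis finite_keys)
qed

context semimodule
begin

lemma monoid_scale_superset:
  assumes "finite A" "finite B" "Poly_Mapping.keys f \<subseteq> A" "Poly_Mapping.keys p \<subseteq> B"
  shows "monoid_scale scale f p =
     (\<Sum>g\<in>A. \<Sum>h\<in>B. Poly_Mapping.single (g + h)
        (scale (Poly_Mapping.lookup f g) (Poly_Mapping.lookup p h)))"
proof -
  have "monoid_scale scale f p = (\<Sum>g\<in>Poly_Mapping.keys f. \<Sum>h\<in>B. Poly_Mapping.single (g + h)
        (scale (Poly_Mapping.lookup f g) (Poly_Mapping.lookup p h)))"
    unfolding monoid_scale_def
    by (intro sum.cong refl sum.mono_neutral_left assms)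
       (auto simp: in_keys_iff scale_zero_right)
  also have "\<dots> = (\<Sum>g\<in>A. \<Sum>h\<in>B. Poly_Mapping.single (g + h)
        (scale (Poly_Mapping.lookup f g) (Poly_Mapping.lookup p h)))"
    by (intro sum.mono_neutral_left assms) (auto simp: in_keys_iff scale_zero_left)
  finally show ?thesis .
qed

lemma monoid_scale_single:
  "monoid_scale scale (Poly_Mapping.single g s) (Poly_Mapping.single h m) =
     Poly_Mapping.single (g + h) (scale s m)"
  by (subst monoid_scale_superset[of "{g}" "{h}"]) auto

lemma monoid_scale_add_left:
  "monoid_scale scale (f + f') p = monoid_scale scale f p + monoid_scale scale f' p"
proof -
  let ?A = "Poly_Mapping.keys f \<union> Poly_Mapping.keys f'" and ?B = "Poly_Mapping.keys p"
  show ?thesis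
    using keys_add[of f f']
    by (simp add: monoid_scale_superset[of ?A ?B] lookup_add scale_add_left single_add sum.distrib)
qed

lemma monoid_scale_add_right:
  "monoid_scale scale f (p + p') = monoid_scale scale f p + monoid_scale scale f p'"
proof -
  let ?A = "Poly_Mapping.keys f" and ?B = "Poly_Mapping.keys p \<union> Poly_Mapping.keys p'"
  show ?thesis
    using keys_add[of p p']
    by (simp add: monoid_scale_superset[of ?A ?B] lookup_add scale_add_right single_add sum.distrib)
qed

lemma monoid_scale_zero_left: "monoid_scale scale 0 p = 0"
  by (simp add: monoid_scale_def)

lemma monoid_scale_zero_right: "monoid_scale scale f 0 = 0"
  by (simp add: monoid_scale_def)

lemma monoid_scale_one: "monoid_scale scale 1 p = p"
proof (induction p rule: poly_mapping_add_single_induct)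
  case (2 k v)
  show ?case
    by (metis add_0 monoid_scale_single scale_one single_one)
qed (simp_all add: monoid_scale_zero_right monoid_scale_add_right)

lemma monoid_scale_monoid_scale:
  "monoid_scale scale f (monoid_scale scale f' p) = monoid_scale scale (f * f') p"
proof (induction f rule: poly_mapping_add_single_induct)
  case (2 k v)
  show ?case
  proof (induction f' rule: poly_mapping_add_single_induct)
    case (2 k' v')
    show ?case
      by (induction p rule: poly_mapping_add_single_induct)
         (simp_all add: monoid_scale_zero_right monoid_scale_add_right monoid_scale_single
            mult_single scale_scale add.assoc)
  qed (simp_all add: monoid_scale_zero_left monoid_scale_zero_right monoid_scale_add_left
         monoid_scale_add_right distrib_left)
qed (simp_all add: monoid_scale_zero_left monoid_scale_add_left distrib_right)

theorem semimodule_monoid_scale: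
  "semimodule (monoid_scale scale :: ('g::comm_monoid_add \<Rightarrow>\<^sub>0 's) \<Rightarrow> _)"
  by standard
     (simp_all add: monoid_scale_zero_left monoid_scale_zero_right monoid_scale_add_left
        monoid_scale_add_right monoid_scale_one monoid_scale_monoid_scale)

end

end

theory Submission
  imports Defs
begin

text \<open>
  The key is McCoy's theorem: if \<open>f q = 0\<close> with \<open>q \<noteq> 0\<close> of minimal support, then every coefficient
  of \<open>f\<close> kills \<open>q\<close>. Indeed, if \<open>a + b\<close> is represented only once as a sum of elements of the two
  supports, then \<open>f\<^sub>a q\<^sub>b = 0\<close>, so \<open>f\<^sub>a q\<close> has smaller support and is annihilated by \<open>f\<close>, whence
  \<open>f\<^sub>a q = 0\<close>; the term of \<open>f\<close> at \<open>a\<close> can then be dropped without subtracting anything.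
  Uniquely represented sums exist because any finite subset of \<open>G\<close> is totally ordered by some
  translation-invariant order. Property (A) turns the common annihilator in \<open>M\<close> of the coefficients
  of \<open>f\<close> into one in \<open>S\<close>.
\<close>

section \<open>Compatible orders and uniquely represented sums\<close>

abbreviation (input) nmult :: "nat \<Rightarrow> 'g::comm_monoid_add \<Rightarrow> 'g" where
  "nmult n a \<equiv> (\<Sum>i<n. a)"

lemma nmult_add: "nmult (n + m) a = nmult n a + nmult m a"
  by (induction m) (simp_all add: ac_simps)

lemma nmult_nmult: "nmult n (nmult m a) = nmult (n * m) a"
  by (induction n) (simp_all add: nmult_add ac_simps)

text \<open>The order is partial; comparability is added later, one pair at a time. Equality is such
  an order exactly when the monoid is cancellative and torsion-free, which gives the construction
  its starting point.\<close>

locale compatible_order =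
  fixes le :: "'g::comm_monoid_add \<Rightarrow> 'g \<Rightarrow> bool"
  assumes refl: "le a a"
    and trans: "le a b \<Longrightarrow> le b c \<Longrightarrow> le a c"
    and antisym: "le a b \<Longrightarrow> le b a \<Longrightarrow> a = b"
    and add_right_iff: "le (a + c) (b + c) \<longleftrightarrow> le a b"
    and nmult_cancel: "n \<ge> 1 \<Longrightarrow> le (nmult n a) (nmult n b) \<Longrightarrow> le a b"
begin

lemma add_left_iff: "le (c + a) (c + b) \<longleftrightarrow> le a b"
  using add_right_iff[of a c b] by (simp add: add.commute)

lemma add_mono: "le a b \<Longrightarrow> le c d \<Longrightarrow> le (a + c) (b + d)"
  by (meson add_left_iff add_right_iff trans)

lemma nmult_mono: "le a b \<Longrightarrow> le (nmult n a) (nmult n b)"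
  by (induction n) (simp_all add: refl add_mono)

lemma add_left_cancel: "(a::'g) + b = a + c \<Longrightarrow> b = c"
  using add_left_iff[of a b c] add_left_iff[of a c b] by (simp add: antisym refl)

text \<open>
  In a group this says that a positive multiple of \<open>b - a\<close> is a positive element plus a
  multiple of \<open>y - x\<close>; the terms are moved so that no subtraction occurs.
\<close>

definition adjoin :: "'g \<Rightarrow> 'g \<Rightarrow> 'g \<Rightarrow> 'g \<Rightarrow> bool" where
  "adjoin x y a b \<longleftrightarrow> (\<exists>k\<ge>1. \<exists>n. le (nmult k a + nmult n y) (nmult k b + nmult n x))"

lemma adjoin_extends: "le a b \<Longrightarrow> adjoin x y a b"
  unfolding adjoin_def by (rule exI[of _ 1]) (auto intro!: exI[of _ 0])

lemma adjoin_new: "adjoin x y x y"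
  unfolding adjoin_def
  \<comment> \<open>With \<open>k = n = 1\<close> both sides equal \<open>x + y\<close>.\<close>
  by (rule exI[of _ 1]) (auto intro!: exI[of _ 1] simp: refl add.commute)

lemma adjoin_scaled:
  assumes "le (nmult k a + nmult n y) (nmult k b + nmult n x)"
  shows "le (nmult (l * k) a + nmult (l * n) y) (nmult (l * k) b + nmult (l * n) x)"
  using nmult_mono[OF assms, of l] by (simp add: sum.distrib nmult_nmult)

text \<open>Scaling the first inequality by \<open>l\<close> and the second by \<open>k\<close>
  gives both the same multiple of \<open>b\<close>. Adding \<open>nmult (k * m) y\<close> to the
  first and \<open>nmult (l * n) x\<close> to the second makes them chain.\<close>

lemma adjoin_trans:
  assumes "adjoin x y a b" "adjoin x y b c"
  shows "adjoin x y a c"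
proof -
  obtain k n where kn: "k \<ge> 1" "le (nmult k a + nmult n y) (nmult k b + nmult n x)"
    using assms(1) unfolding adjoin_def by blast
  obtain l m where lm: "l \<ge> 1" "le (nmult l b + nmult m y) (nmult l c + nmult m x)"
    using assms(2) unfolding adjoin_def by blast
  have "le (nmult (l * k) a + nmult (l * n) y + nmult (k * m) y)
           (nmult (l * k) b + nmult (l * n) x + nmult (k * m) y)"
    using adjoin_scaled[OF kn(2), of l] by (simp add: add_right_iff)
  moreover have "le (nmult (k * l) b + nmult (k * m) y + nmult (l * n) x)
           (nmult (k * l) c + nmult (k * m) x + nmult (l * n) x)"
    using adjoin_scaled[OF lm(2), of k] by (simp add: add_right_iff)
  ultimately have "le (nmult (l * k) a + nmult (l * n + k * m) y)
      (nmult (l * k) c + nmult (l * n + k * m) x)"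
    unfolding nmult_add by (simp add: ac_simps) (meson trans)
  moreover have "l * k \<ge> 1"
    using kn lm by simp
  ultimately show ?thesis
    unfolding adjoin_def by blast
qed

text \<open>Adding the two inequalities, scaled to the common factor \<open>l * k\<close>, cancels
  \<open>a\<close> and \<open>b\<close> and leaves \<open>le (nmult N y) (nmult N x)\<close> with
  \<open>N = l * n + k * m\<close>. As \<open>le y x\<close> fails, \<open>N = 0\<close>; hence
  \<open>n = m = 0\<close>, and both inequalities are about \<open>le\<close> alone.\<close>

lemma adjoin_antisym:
  assumes "\<not> le y x" "adjoin x y a b" "adjoin x y b a"
  shows "a = b"
proof -
  obtain k n where kn: "k \<ge> 1" "le (nmult k a + nmult n y) (nmult k b + nmult n x)"
    using assms(2) unfolding adjoin_def by blast
  obtain l m where lm: "l \<ge> 1" "le (nmult l b + nmult m y) (nmult l a + nmult m x)"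
    using assms(3) unfolding adjoin_def by blast
  have "le ((nmult (l * k) a + nmult (l * n) y) + (nmult (k * l) b + nmult (k * m) y))
           ((nmult (l * k) b + nmult (l * n) x) + (nmult (k * l) a + nmult (k * m) x))"
    by (intro add_mono adjoin_scaled kn lm)
  then have "le ((nmult (l * k) a + nmult (l * k) b) + nmult (l * n + k * m) y)
                ((nmult (l * k) a + nmult (l * k) b) + nmult (l * n + k * m) x)"
    unfolding nmult_add by (simp add: ac_simps)
  then have "le (nmult (l * n + k * m) y) (nmult (l * n + k * m) x)"
    by (simp only: add_left_iff)
  then have "l * n + k * m = 0"
    using nmult_cancel[of "l * n + k * m" y x] assms(1) by linarith
  then have "n = 0" "m = 0"
    using kn(1) lm(1) by auto
  then show ?thesis
    using nmult_cancel[OF kn(1), of a b] nmult_cancel[OF lm(1), of b a] kn(2) lm(2)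
    by (simp add: antisym)
qed

lemma compatible_order_adjoin:
  assumes "\<not> le y x"
  shows "compatible_order (adjoin x y)"
proof
  show "adjoin x y a a" for a
    by (simp add: adjoin_extends refl)
  show "adjoin x y a b \<Longrightarrow> adjoin x y b c \<Longrightarrow> adjoin x y a c" for a b c
    by (rule adjoin_trans)
  show "adjoin x y a b \<Longrightarrow> adjoin x y b a \<Longrightarrow> a = b" for a b
    by (rule adjoin_antisym[OF assms])
  show "adjoin x y (a + c) (b + c) \<longleftrightarrow> adjoin x y a b" for a b c
  proof -
    have "le (nmult k (a + c) + nmult n y) (nmult k (b + c) + nmult n x) \<longleftrightarrow>
          le (nmult k a + nmult n y) (nmult k b + nmult n x)" for k n
      using add_left_iff[of "nmult k c" "nmult k a + nmult n y" "nmult k b + nmult n x"]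
      by (simp add: sum.distrib ac_simps)
    then show ?thesis
      unfolding adjoin_def by simp
  qed
  \<comment> \<open>The positive factor \<open>k\<close> in \<open>adjoin\<close> absorbs
    \<open>n\<close>.\<close>
  show "adjoin x y a b" if n: "1 \<le> n" and ab: "adjoin x y (nmult n a) (nmult n b)" for n a b
  proof -
    obtain k m where "k \<ge> 1" "le (nmult (k * n) a + nmult m y) (nmult (k * n) b + nmult m x)"
      using ab unfolding adjoin_def nmult_nmult by blast
    moreover have "k * n \<ge> 1"
      using \<open>k \<ge> 1\<close> n by simp
    ultimately show ?thesis
      unfolding adjoin_def by blast
  qed
qed

lemma ex_greatest:
  assumes "finite A" "A \<noteq> {}" "\<And>a b. a \<in> A \<Longrightarrow> b \<in> A \<Longrightarrow> le a b \<or> le b a"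
  shows "\<exists>a\<in>A. \<forall>b\<in>A. le b a"
  using assms
proof (induction A rule: finite_ne_induct)
  case (singleton x)
  then show ?case by (simp add: refl)
next
  case (insert x A)
  then obtain a where a: "a \<in> A" "\<forall>b\<in>A. le b a"
    by blast
  show ?case
  proof (cases "le x a")
    case True
    then show ?thesis using a by blast
  next
    case False
    then have "le a x" using insert.prems[of x a] a by blast
    then show ?thesis using a refl trans by blast
  qed
qed

end

text \<open>Equality is the initial order, and each pair \<open>(x, y)\<close> is adjoined in turn
  unless \<open>le y x\<close> already holds. Since \<open>adjoin\<close> extends \<open>le\<close>,
  pairs once comparable stay so.\<close>

lemma ex_compatible_order_comparable:
  fixes P :: "('g::comm_monoid_add \<times> 'g) set"
  assumes cancel: "\<And>a b c :: 'g. a + b = a + c \<Longrightarrow> b = c"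
    and torsion_free: "\<And>(n::nat) (a::'g) b. n \<ge> 1 \<Longrightarrow> nmult n a = nmult n b \<Longrightarrow> a = b"
    and "finite P"
  shows "\<exists>le. compatible_order le \<and> (\<forall>(x, y)\<in>P. le x y \<or> le y x)"
  using \<open>finite P\<close>
proof (induction P rule: finite_induct)
  case empty
  have "a + c = b + c \<longleftrightarrow> a = b" for a b c :: 'g
    using cancel[of c a b] by (auto simp: add.commute)
  then have "compatible_order ((=) :: 'g \<Rightarrow> 'g \<Rightarrow> bool)"
    by unfold_locales (auto intro: torsion_free)
  then show ?case by blast
next
  case (insert p P)
  obtain x y where p: "p = (x, y)"
    by (cases p)
  obtain le where le: "compatible_order le" "\<forall>(x, y)\<in>P. le x y \<or> le y x"
    using insert.IH by blast
  interpret compatible_order le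
    by (rule le(1))
  show ?case
  proof (cases "le y x")
    case True
    then show ?thesis using le p by blast
  next
    case False
    have "\<forall>(u, v)\<in>insert p P. adjoin x y u v \<or> adjoin x y v u"
      using le(2) p adjoin_new adjoin_extends by fast
    then show ?thesis
      using compatible_order_adjoin[OF False] by blast
  qed
qed

text \<open>The additive form of the unique product property; this is all that \<open>mccoy\<close>
  asks of the monoid.\<close>

definition unique_sums :: "'g::comm_monoid_add itself \<Rightarrow> bool" where
  "unique_sums _ \<longleftrightarrow>
     (\<forall>A B :: 'g set. finite A \<and> A \<noteq> {} \<and> finite B \<and> B \<noteq> {} \<longrightarrow>
        (\<exists>a\<in>A. \<exists>b\<in>B. \<forall>a'\<in>A. \<forall>b'\<in>B. a' + b' = a + b \<longrightarrow> a' = a \<and> b' = b))"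

text \<open>In an order that compares all elements within \<open>A\<close> and within
  \<open>B\<close>, the sum of the two greatest elements is the uniquely represented one.\<close>

lemma unique_sums_if_torsion_free:
  assumes cancel: "\<And>a b c :: 'g::comm_monoid_add. a + b = a + c \<Longrightarrow> b = c"
    and torsion_free: "\<And>(n::nat) (a::'g) b. n \<ge> 1 \<Longrightarrow> nmult n a = nmult n b \<Longrightarrow> a = b"
  shows "unique_sums TYPE('g)"
  unfolding unique_sums_def
proof (intro allI impI)
  fix A B :: "'g set"
  assume AB: "finite A \<and> A \<noteq> {} \<and> finite B \<and> B \<noteq> {}"
  then have "finite (A \<times> A \<union> B \<times> B)"
    by simp
  then obtain le where le: "compatible_order le" "\<forall>(x, y)\<in>A \<times> A \<union> B \<times> B. le x y \<or> le y x"
    using ex_compatible_order_comparable[of "A \<times> A \<union> B \<times> B"] cancel torsion_free by blast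
  interpret compatible_order le
    by (rule le(1))
  obtain a where a: "a \<in> A" "\<forall>a'\<in>A. le a' a"
    using ex_greatest[of A] AB le(2) by blast
  obtain b where b: "b \<in> B" "\<forall>b'\<in>B. le b' b"
    using ex_greatest[of B] AB le(2) by blast
  have "a' = a \<and> b' = b" if "a' \<in> A" "b' \<in> B" and eq: "a' + b' = a + b" for a' b'
  proof -
    \<comment> \<open>Adding \<open>b'\<close> to \<open>le a' a\<close> and replacing
      \<open>a' + b'\<close> by \<open>a + b\<close>. Cancelling \<open>a\<close> gives
      \<open>le b b'\<close>, and \<open>b\<close> is greatest.\<close>
    have "le (a + b) (a + b')"
      using that a by (metis add_right_iff)
    then have "b' = b"
      using that b by (simp add: add_left_iff antisym)
    then show ?thesis
      using eq add_left_cancel[of b a' a] by (simp add: add.commute)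
  qed
  then show "\<exists>a\<in>A. \<exists>b\<in>B. \<forall>a'\<in>A. \<forall>b'\<in>B. a' + b' = a + b \<longrightarrow> a' = a \<and> b' = b"
    using a b by blast
qed

section \<open>McCoy's theorem\<close>

context semimodule
begin

text \<open>In the double sum only the term at \<open>(a, b)\<close> reaches the exponent
  \<open>a + b\<close>.\<close>

lemma lookup_monoid_scale_unique_sum:
  assumes "a \<in> Poly_Mapping.keys f" "b \<in> Poly_Mapping.keys p"
    and "\<forall>a'\<in>Poly_Mapping.keys f. \<forall>b'\<in>Poly_Mapping.keys p.
           a' + b' = a + b \<longrightarrow> a' = a \<and> b' = b"
  shows "Poly_Mapping.lookup (monoid_scale scale f p) (a + b) =
    scale (Poly_Mapping.lookup f a) (Poly_Mapping.lookup p b)"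
proof -
  have "Poly_Mapping.lookup (monoid_scale scale f p) (a + b) =
    (\<Sum>g\<in>Poly_Mapping.keys f. \<Sum>h\<in>Poly_Mapping.keys p.
       scale (Poly_Mapping.lookup f g) (Poly_Mapping.lookup p h) when g + h = a + b)"
    by (simp add: monoid_scale_def lookup_sum lookup_single)
  also have "\<dots> = (\<Sum>g\<in>Poly_Mapping.keys f. \<Sum>h\<in>Poly_Mapping.keys p.
       if h = b then if g = a then scale (Poly_Mapping.lookup f a) (Poly_Mapping.lookup p b) else 0 else 0)"
    using assms(3) by (intro sum.cong refl) (auto simp: when_def)
  finally show ?thesis
    using assms(1,2) by (simp add: sum.delta)
qed

text \<open>Constants act coefficientwise, so that a coefficient of \<open>f\<close> kills
  \<open>q\<close> can be expressed inside M[G].\<close>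

lemma lookup_monoid_scale_single_zero:
  "Poly_Mapping.lookup (monoid_scale scale (Poly_Mapping.single 0 s) p) g =
     scale s (Poly_Mapping.lookup p g)"
  by (induction p rule: poly_mapping_add_single_induct)
     (simp_all add: monoid_scale_zero_right scale_zero_right monoid_scale_single
       monoid_scale_add_right lookup_add scale_add_right lookup_single when_def)

text \<open>Minimality is demanded only against constant multiples of \<open>q\<close> and does not
  mention \<open>f\<close>, so it stays available while \<open>f\<close> loses terms in the
  induction on the size of its support.\<close>

lemma mccoy_minimal:
  fixes q :: "'g::comm_monoid_add \<Rightarrow>\<^sub>0 'm"
  assumes "unique_sums TYPE('g)"
    and "q \<noteq> 0"
    and minimal: "\<And>s. monoid_scale scale (Poly_Mapping.single 0 s) q \<noteq> 0 \<Longrightarrow>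
      card (Poly_Mapping.keys q) \<le>
        card (Poly_Mapping.keys (monoid_scale scale (Poly_Mapping.single 0 s) q))"
    and "monoid_scale scale f q = 0"
  shows "monoid_scale scale (Poly_Mapping.single 0 (Poly_Mapping.lookup f g)) q = 0"
  using assms(4)
proof (induction "card (Poly_Mapping.keys f)" arbitrary: f rule: less_induct)
  case less
  show ?case
  proof (cases "f = 0")
    case True
    then show ?thesis by (simp add: monoid_scale_zero_left)
  next
    case False
    then obtain a b where ab: "a \<in> Poly_Mapping.keys f" "b \<in> Poly_Mapping.keys q"
      "\<forall>a'\<in>Poly_Mapping.keys f. \<forall>b'\<in>Poly_Mapping.keys q.
         a' + b' = a + b \<longrightarrow> a' = a \<and> b' = b"
      using \<open>unique_sums TYPE('g)\<close> \<open>q \<noteq> 0\<close> unfolding unique_sums_def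
      by (metis finite_keys keys_eq_empty)
    let ?s = "Poly_Mapping.lookup f a"
    let ?q = "monoid_scale scale (Poly_Mapping.single 0 ?s) q"
    have "scale ?s (Poly_Mapping.lookup q b) = 0"
      using lookup_monoid_scale_unique_sum[OF ab] less.prems by simp
    \<comment> \<open>The exponent \<open>b\<close> drops out, and multiplying by a constant creates
      no new exponents.\<close>
    then have "Poly_Mapping.keys ?q \<subseteq> Poly_Mapping.keys q - {b}"
      by (auto simp: in_keys_iff lookup_monoid_scale_single_zero scale_zero_right)
    then have "Poly_Mapping.keys ?q \<subset> Poly_Mapping.keys q"
      using ab(2) by blast
    then have kills: "?q = 0"
      using minimal[of ?s] psubset_card_mono[OF finite_keys] by (metis leD)
    define f' where "f' = Poly_Mapping.update a 0 f"
    have split: "f = Poly_Mapping.single a 1 * Poly_Mapping.single 0 ?s + f'"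
      by (rule poly_mapping_eqI)
         (simp add: f'_def mult_single lookup_add lookup_single lookup_update when_def)
    have "monoid_scale scale (Poly_Mapping.single a 1 * Poly_Mapping.single 0 ?s) q = 0"
      using kills by (simp add: monoid_scale_monoid_scale[symmetric] monoid_scale_zero_right)
    \<comment> \<open>Since the split-off term kills \<open>q\<close>, the hypothesis on
      \<open>f\<close> reduces to one on \<open>f'\<close>.\<close>
    then have "monoid_scale scale f' q = 0"
      using less.prems by (subst (asm) split) (simp add: monoid_scale_add_left)
    moreover have "card (Poly_Mapping.keys f') < card (Poly_Mapping.keys f)"
      unfolding f'_def keys_update using card_Diff1_less[OF finite_keys ab(1)] by simp
    ultimately have "monoid_scale scale (Poly_Mapping.single 0 (Poly_Mapping.lookup f' g)) q = 0"
      using less.hyps by blast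
    \<comment> \<open>At \<open>a\<close> the coefficient is \<open>?s\<close>; elsewhere
      \<open>f\<close> and \<open>f'\<close> agree.\<close>
    then show ?thesis
      using kills by (cases "g = a") (simp_all add: f'_def lookup_update)
  qed
qed

theorem mccoy:
  fixes p :: "'g::comm_monoid_add \<Rightarrow>\<^sub>0 'm"
  assumes "unique_sums TYPE('g)"
    and "p \<noteq> 0" "monoid_scale scale f p = 0"
  shows "\<exists>m. m \<noteq> 0 \<and> (\<forall>g. scale (Poly_Mapping.lookup f g) m = 0)"
proof -
  obtain q where q: "q \<noteq> 0" "monoid_scale scale f q = 0"
    and q_le: "\<And>r. r \<noteq> 0 \<Longrightarrow> monoid_scale scale f r = 0 \<Longrightarrow>
      card (Poly_Mapping.keys q) \<le> card (Poly_Mapping.keys r)"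
    using ex_has_least_nat[of "\<lambda>q. q \<noteq> 0 \<and> monoid_scale scale f q = 0" p
        "\<lambda>q. card (Poly_Mapping.keys q)"] assms(2,3) by blast
  \<comment> \<open>Constant multiples of \<open>q\<close> are again annihilated by
    \<open>f\<close>, so the choice of \<open>q\<close> yields the minimality that
    \<open>mccoy_minimal\<close> requires.\<close>
  have "monoid_scale scale f (monoid_scale scale (Poly_Mapping.single 0 s) q) = 0" for s
    using q(2) by (metis monoid_scale_monoid_scale monoid_scale_zero_right mult.commute)
  then have "monoid_scale scale (Poly_Mapping.single 0 (Poly_Mapping.lookup f g)) q = 0" for g
    using mccoy_minimal[OF assms(1) q(1) _ q(2)] q_le by blast
  then have "scale (Poly_Mapping.lookup f g) (Poly_Mapping.lookup q h) = 0" for g h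
    by (metis lookup_monoid_scale_single_zero lookup_zero)
  \<comment> \<open>Any nonzero coefficient of \<open>q\<close> can serve as
    \<open>m\<close>.\<close>
  moreover obtain h where "Poly_Mapping.lookup q h \<noteq> 0"
    using q(1) by (metis lookup_zero poly_mapping_eqI)
  ultimately show ?thesis by blast
qed

lemma semiring_ideal_annihilator: "semiring_ideal {s. scale s m = 0}"
  unfolding semiring_ideal_def
  by (auto simp: scale_add_left scale_zero_left scale_scale[symmetric] scale_zero_right
      intro: exI[of _ 0])

end

section \<open>Property (A) and the equivalence\<close>

lemma lookup_mult_single_zero:
  "Poly_Mapping.lookup (f * Poly_Mapping.single 0 s) g =
     Poly_Mapping.lookup f g * (s::'s::comm_semiring_1)"
  by (induction f rule: poly_mapping_add_single_induct)
     (simp_all add: distrib_right lookup_add mult_single lookup_single when_def)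

text \<open>The annihilator of \<open>m\<close> is an ideal containing \<open>A\<close>, hence
  contains \<open>ideal_generated A\<close>. By torsion-freeness that ideal then consists of zero
  divisors of the semiring, and Property (A) applies to it.\<close>

lemma property_A_annihilator:
  fixes A :: "'s::comm_semiring_1 set" and scale :: "'s \<Rightarrow> 'm::comm_monoid_add \<Rightarrow> 'm"
  assumes "property_A TYPE('s)" "semimodule scale" "torsion_free scale" "finite A"
    and "m \<noteq> 0" "\<And>a. a \<in> A \<Longrightarrow> scale a m = 0"
  shows "\<exists>s. s \<noteq> 0 \<and> (\<forall>a\<in>A. s * a = 0)"
proof -
  have "ideal_generated A \<subseteq> {s. scale s m = 0}"
    unfolding ideal_generated_def
    using semimodule.semiring_ideal_annihilator[OF assms(2), of m] assms(6) by blast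
  then have "ideal_generated A \<subseteq> zero_divisors (*)"
    using assms(3,5) unfolding torsion_free_def zero_divisors_def by blast
  then obtain s where "s \<noteq> 0" "\<forall>a\<in>ideal_generated A. s * a = 0"
    using assms(1,4) unfolding property_A_def finitely_generated_ideal_def by blast
  then show ?thesis
    unfolding ideal_generated_def by blast
qed

theorem theorem2p31:
  fixes scale :: "'s::comm_semiring_1 \<Rightarrow> 'm::comm_monoid_add \<Rightarrow> 'm"
  assumes "property_A TYPE('s)"
    and "semimodule scale"
    and "\<exists>m::'m. m \<noteq> 0"
    and G_cancellative: "\<And>a b c :: 'g::comm_monoid_add. a + b = a + c \<Longrightarrow> b = c"
    and G_torsion_free: "\<And>(n::nat) (a::'g) b. n \<ge> 1 \<Longrightarrow> (\<Sum>i<n. a) = (\<Sum>i<n. b) \<Longrightarrow> a = b"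
  shows "torsion_free (monoid_scale scale :: ('g \<Rightarrow>\<^sub>0 's) \<Rightarrow> ('g \<Rightarrow>\<^sub>0 'm) \<Rightarrow> ('g \<Rightarrow>\<^sub>0 'm))
         \<longleftrightarrow> torsion_free scale"
proof
  interpret semimodule scale by (rule assms(2))
  assume tf: "torsion_free (monoid_scale scale :: ('g \<Rightarrow>\<^sub>0 's) \<Rightarrow> ('g \<Rightarrow>\<^sub>0 'm) \<Rightarrow> ('g \<Rightarrow>\<^sub>0 'm))"
  show "torsion_free scale"
    unfolding torsion_free_def
  proof
    fix s
    assume "s \<in> zero_divisors scale"
    then obtain m where m: "m \<noteq> 0" "scale s m = 0"
      unfolding zero_divisors_def by blast
    \<comment> \<open>Placing \<open>s\<close> and \<open>m\<close> at exponent 0 carries the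
      relation over to M[G].\<close>
    have "monoid_scale scale (Poly_Mapping.single (0::'g) s) (Poly_Mapping.single 0 m) = 0"
      using m(2) by (simp add: monoid_scale_single)
    moreover have "Poly_Mapping.single (0::'g) m \<noteq> 0"
      using m(1) by (metis lookup_single_eq lookup_zero)
    ultimately have "Poly_Mapping.single (0::'g) s \<in> zero_divisors (*)"
      using tf unfolding torsion_free_def zero_divisors_def by blast
    then obtain f :: "'g \<Rightarrow>\<^sub>0 's" where f: "f \<noteq> 0" "Poly_Mapping.single 0 s * f = 0"
      unfolding zero_divisors_def by blast
    \<comment> \<open>Multiplying by the constant \<open>s\<close> acts coefficientwise, so any
      nonzero coefficient of \<open>f\<close> shows that \<open>s\<close> is a zero divisor.\<close>
    obtain g where "Poly_Mapping.lookup f g \<noteq> 0"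
      using f(1) by (metis lookup_zero poly_mapping_eqI)
    moreover have "s * Poly_Mapping.lookup f g = 0"
      using f(2) by (metis lookup_mult_single_zero lookup_zero mult.commute)
    ultimately show "s \<in> zero_divisors (*)"
      unfolding zero_divisors_def by blast
  qed
next
  interpret semimodule scale by (rule assms(2))
  assume tf: "torsion_free scale"
  show "torsion_free (monoid_scale scale :: ('g \<Rightarrow>\<^sub>0 's) \<Rightarrow> ('g \<Rightarrow>\<^sub>0 'm) \<Rightarrow> ('g \<Rightarrow>\<^sub>0 'm))"
    unfolding torsion_free_def
  proof
    fix f :: "'g \<Rightarrow>\<^sub>0 's"
    assume "f \<in> zero_divisors (monoid_scale scale)"
    then obtain p where "p \<noteq> 0" "monoid_scale scale f p = 0"
      unfolding zero_divisors_def by blast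
    moreover have "unique_sums TYPE('g)"
      by (rule unique_sums_if_torsion_free) (erule G_cancellative, erule (1) G_torsion_free)
    ultimately obtain m where "m \<noteq> 0" "\<And>g. scale (Poly_Mapping.lookup f g) m = 0"
      using mccoy by blast
    \<comment> \<open>Only the finitely many coefficients on the support form the set
      \<open>A\<close> of \<open>property_A_annihilator\<close>.\<close>
    then obtain s where s: "s \<noteq> 0"
      "\<forall>a\<in>Poly_Mapping.lookup f ` Poly_Mapping.keys f. s * a = 0"
      using property_A_annihilator[OF assms(1,2) tf
          finite_imageI[OF finite_keys, of "Poly_Mapping.lookup f" f]]
      by blast
    \<comment> \<open>Off the support the coefficient is 0, so \<open>s\<close> kills every
      coefficient and the constant \<open>s\<close> annihilates \<open>f\<close>.\<close>
    have "Poly_Mapping.lookup f g * s = 0" for g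
      using s(2) by (cases "g \<in> Poly_Mapping.keys f") (auto simp: mult.commute in_keys_iff)
    then have "f * Poly_Mapping.single 0 s = 0"
      by (intro poly_mapping_eqI) (simp add: lookup_mult_single_zero)
    moreover have "Poly_Mapping.single (0::'g) s \<noteq> 0"
      using s(1) by (metis lookup_single_eq lookup_zero)
    ultimately show "f \<in> zero_divisors (*)"
      unfolding zero_divisors_def by blast
  qed
qed

end
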